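(* For every integer $n\ge 17$ there exists a self-dual discrete imprecise copula $(P,Q)$ on $L_n^2$ such that both $P$ and $Q$ are discrete quasi-copulas of minimal range on $L_n^2$ and $(P,Q)$ does not avoid sure loss.
   Context: Let $L_n=\{0,1,\dots,n\}$. All functions below are functions $L_n^2\to[0,n]$, and inequalities between functions are pointwise. Boundary condition (B): $F(r,0)=F(0,s)=0$, $F(r,n)=r$, $F(n,s)=s$ for all $r,s\in L_n$. A discrete copula on $L_n^2$ is a function $C:L_n^2\to[0,n]$ satisfying (B) and $C(x_1,y_1)+C(x_2,y_2)\ge C(x_1,y_2)+C(x_2,y_1)$ for all $x_1\le x_2$, $y_1\le y_2$ in $L_n$. A discrete quasi-copula on $L_n^2$ is a function $Q:L_n^2\to[0,n]$ satisfying (B) and the same inequality whenever at least one of $x_1,x_2,y_1,y_2$ equals $0$ or $n$. A discrete quasi-copula $Q$ on $L_n^2$ is of minimal range if its image is exactly $L_n$, i.e. it takes only integer values. A pair $(P,Q)$ of functions $L_n^2\to[0,n]$ is a discrete imprecise copula if both $P$ and $Q$ satisfy (B) and for all $0\le i\le j\le n$, $0\le k\le l\le n$: $Q(i,k)+P(j,l)-P(i,l)-P(j,k)\ge 0$, $P(i,k)+Q(j,l)-P(i,l)-P(j,k)\ge 0$, $Q(i,k)+Q(j,l)-Q(i,l)-P(j,k)\ge 0$, $Q(i,k)+Q(j,l)-P(i,l)-Q(j,k)\ge 0$. (It is known that then $P$ and $Q$ are discrete quasi-copulas with $P\le Q$.) A discrete imprecise copula $(P,Q)$ avoids sure loss if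 there exists a discrete copula $C$ on $L_n^2$ with $P\le C\le Q$. Defects: for a rectangle $R=[i,j]\times[k,l]$ with $0\le i\le j\le n$, $0\le k\le l\le n$ (where $[i,j]=\{i,\dots,j\}$) and a discrete quasi-copula $F$, put $V_F(R)=F(i,k)+F(j,l)-F(i,l)-F(j,k)$. For $(r,s)\in L_n^2$ put $\mathcal R_{\searrow}(r,s)=\{[r,r+i]\times[s,s+j]: 1\le i\le n-r,\ 1\le j\le n-s\}$, $\mathcal R_{\swarrow}(r,s)=\{[r,r+i]\times[j,s]: 1\le i\le n-r,\ 1\le j\le s\}$, $\mathcal R_{\nwarrow}(r,s)=\{[i,r]\times[j,s]: 1\le i\le r,\ 1\le j\le s\}$, $\mathcal R_{\nearrow}(r,s)=\{[i,r]\times[s,s+j]: 1\le i\le r,\ 1\le j\le n-s\}$, and for $*\in\{\searrow,\swarrow,\nwarrow,\nearrow\}$ let $D_*^F(r,s)=\min\big(\{0\}\cup\{V_F(R): R\in\mathcal R_*(r,s)\}\big)$. Let $D_M^F=\min\{D_{\searrow}^F,D_{\nwarrow}^F\}$ and $D_O^F=\min\{D_{\swarrow}^F,D_{\nearrow}^F\}$ (pointwise), and $F_M=F-D_M^F$, $F_O=F+D_O^F$. A discrete imprecise copula $(P,Q)$ is self-dual if $P_M=Q$ and $Q_O=P$. *)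

theory Defs
  imports Complex_Main
begin

(* A function on L_n^2 is represented by a total function nat => nat => real whose
   values outside {0..n} x {0..n} are irrelevant: every notion below only inspects
   arguments in L n. *)

abbreviation L :: "nat \<Rightarrow> nat set" where
  "L n \<equiv> {0..n}"

definition grid_function :: "nat \<Rightarrow> (nat \<Rightarrow> nat \<Rightarrow> real) \<Rightarrow> bool" where
  "grid_function n F \<longleftrightarrow> (\<forall>r\<in>L n. \<forall>s\<in>L n. 0 \<le> F r s \<and> F r s \<le> real n)"

definition boundary_condition :: "nat \<Rightarrow> (nat \<Rightarrow> nat \<Rightarrow> real) \<Rightarrow> bool" where
  "boundary_condition n F \<longleftrightarrow>
     (\<forall>r\<in>L n. F r 0 = 0 \<and> F r n = real r) \<and>
     (\<forall>s\<in>L n. F 0 s = 0 \<and> F n s = real s)"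

definition discrete_copula :: "nat \<Rightarrow> (nat \<Rightarrow> nat \<Rightarrow> real) \<Rightarrow> bool" where
  "discrete_copula n C \<longleftrightarrow>
     grid_function n C \<and> boundary_condition n C \<and>
     (\<forall>x1\<in>L n. \<forall>x2\<in>L n. \<forall>y1\<in>L n. \<forall>y2\<in>L n.
        x1 \<le> x2 \<longrightarrow> y1 \<le> y2 \<longrightarrow> C x1 y1 + C x2 y2 \<ge> C x1 y2 + C x2 y1)"

definition discrete_quasi_copula :: "nat \<Rightarrow> (nat \<Rightarrow> nat \<Rightarrow> real) \<Rightarrow> bool" where
  "discrete_quasi_copula n Q \<longleftrightarrow>
     grid_function n Q \<and> boundary_condition n Q \<and>
     (\<forall>x1\<in>L n. \<forall>x2\<in>L n. \<forall>y1\<in>L n. \<forall>y2\<in>L n.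
        x1 \<le> x2 \<longrightarrow> y1 \<le> y2 \<longrightarrow> {x1, x2, y1, y2} \<inter> {0, n} \<noteq> {} \<longrightarrow>
        Q x1 y1 + Q x2 y2 \<ge> Q x1 y2 + Q x2 y1)"

definition minimal_range :: "nat \<Rightarrow> (nat \<Rightarrow> nat \<Rightarrow> real) \<Rightarrow> bool" where
  "minimal_range n Q \<longleftrightarrow> (\<lambda>(r, s). Q r s) ` (L n \<times> L n) = real ` L n"

definition discrete_imprecise_copula ::
    "nat \<Rightarrow> (nat \<Rightarrow> nat \<Rightarrow> real) \<Rightarrow> (nat \<Rightarrow> nat \<Rightarrow> real) \<Rightarrow> bool" where
  "discrete_imprecise_copula n P Q \<longleftrightarrow>
     grid_function n P \<and> grid_function n Q \<and>
     boundary_condition n P \<and> boundary_condition n Q \<and>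
     (\<forall>i j k l. i \<le> j \<longrightarrow> j \<le> n \<longrightarrow> k \<le> l \<longrightarrow> l \<le> n \<longrightarrow>
        Q i k + P j l - P i l - P j k \<ge> 0 \<and>
        P i k + Q j l - P i l - P j k \<ge> 0 \<and>
        Q i k + Q j l - Q i l - P j k \<ge> 0 \<and>
        Q i k + Q j l - P i l - Q j k \<ge> 0)"

definition avoids_sure_loss ::
    "nat \<Rightarrow> (nat \<Rightarrow> nat \<Rightarrow> real) \<Rightarrow> (nat \<Rightarrow> nat \<Rightarrow> real) \<Rightarrow> bool" where
  "avoids_sure_loss n P Q \<longleftrightarrow>
     (\<exists>C. discrete_copula n C \<and> (\<forall>r\<in>L n. \<forall>s\<in>L n. P r s \<le> C r s \<and> C r s \<le> Q r s))"

(* The rectangle [i,j] x [k,l] is encoded by the tuple (i, j, k, l) of its corner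
   coordinates. *)

type_synonym rect = "nat \<times> nat \<times> nat \<times> nat"

fun V :: "(nat \<Rightarrow> nat \<Rightarrow> real) \<Rightarrow> rect \<Rightarrow> real" where
  "V F (i, j, k, l) = F i k + F j l - F i l - F j k"

(* SE, SW, NW, NE stand for the directions of the arrows. The first coordinate is the
   row index, growing downwards, and the second is the column index, growing to the
   right. The natural-number subtractions n - r and n - s are only used for r, s \<le> n. *)

definition rects_SE :: "nat \<Rightarrow> nat \<Rightarrow> nat \<Rightarrow> rect set" where
  "rects_SE n r s = {(r, r + i, s, s + j) | i j. i \<in> {1..n - r} \<and> j \<in> {1..n - s}}"

definition rects_SW :: "nat \<Rightarrow> nat \<Rightarrow> nat \<Rightarrow> rect set" where
  "rects_SW n r s = {(r, r + i, j, s) | i j. i \<in> {1..n - r} \<and> j \<in> {1..s}}"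

definition rects_NW :: "nat \<Rightarrow> nat \<Rightarrow> nat \<Rightarrow> rect set" where
  "rects_NW n r s = {(i, r, j, s) | i j. i \<in> {1..r} \<and> j \<in> {1..s}}"

definition rects_NE :: "nat \<Rightarrow> nat \<Rightarrow> nat \<Rightarrow> rect set" where
  "rects_NE n r s = {(i, r, s, s + j) | i j. i \<in> {1..r} \<and> j \<in> {1..n - s}}"

definition defect ::
    "(nat \<Rightarrow> nat \<Rightarrow> nat \<Rightarrow> rect set) \<Rightarrow> nat \<Rightarrow> (nat \<Rightarrow> nat \<Rightarrow> real) \<Rightarrow> nat \<Rightarrow> nat \<Rightarrow> real" where
  "defect \<R> n F r s = Min ({0} \<union> V F ` \<R> n r s)"

definition D_M :: "nat \<Rightarrow> (nat \<Rightarrow> nat \<Rightarrow> real) \<Rightarrow> nat \<Rightarrow> nat \<Rightarrow> real" where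
  "D_M n F r s = min (defect rects_SE n F r s) (defect rects_NW n F r s)"

definition D_O :: "nat \<Rightarrow> (nat \<Rightarrow> nat \<Rightarrow> real) \<Rightarrow> nat \<Rightarrow> nat \<Rightarrow> real" where
  "D_O n F r s = min (defect rects_SW n F r s) (defect rects_NE n F r s)"

definition main_transform :: "nat \<Rightarrow> (nat \<Rightarrow> nat \<Rightarrow> real) \<Rightarrow> nat \<Rightarrow> nat \<Rightarrow> real" where
  "main_transform n F r s = F r s - D_M n F r s"

definition opposite_transform :: "nat \<Rightarrow> (nat \<Rightarrow> nat \<Rightarrow> real) \<Rightarrow> nat \<Rightarrow> nat \<Rightarrow> real" where
  "opposite_transform n F r s = F r s + D_O n F r s"

(* main_transform n P is P_M and opposite_transform n Q is Q_O. *)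

definition self_dual ::
    "nat \<Rightarrow> (nat \<Rightarrow> nat \<Rightarrow> real) \<Rightarrow> (nat \<Rightarrow> nat \<Rightarrow> real) \<Rightarrow> bool" where
  "self_dual n P Q \<longleftrightarrow>
     (\<forall>r\<in>L n. \<forall>s\<in>L n. main_transform n P r s = Q r s) \<and>
     (\<forall>r\<in>L n. \<forall>s\<in>L n. opposite_transform n Q r s = P r s)"

end

theory Submission
  imports Defs
begin

text \<open>
  Suppose that a copula \<open>C\<close> lies between \<open>P\<close> and \<open>Q\<close>. The mass that \<open>C\<close> puts on a large rectangle
  minus some disjoint smaller rectangles inside it (a region with holes) is nonnegative, and it
  is bounded above by evaluating \<open>Q\<close> at the corners that count positively and \<open>P\<close> at the corners
  that count negatively. So sure loss follows as soon as this favourable evaluation is negative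
  for some region.

  The inequalities of an imprecise copula rule this out for regions with at most one hole, but
  not beyond. Each of them says that a rectangle still has nonnegative volume if the
  favourable value is used at three of its corners and the unfavourable one at the fourth. To
  assemble a region with \<open>h\<close> holes in general position, cut it from each of the \<open>4h\<close> corners of
  the holes up to the next wall. This makes \<open>3h + 1\<close> rectangles, and at the end of each of the \<open>4h\<close>
  cuts two rectangles have a common corner, with opposite signs. One of the two must be given
  the unfavourable value there if the two values are to cancel, and each rectangle tolerates this
  once. For \<open>h = 2\<close> there are eight cancellations but only seven rectangles,
  so the argument breaks down.

  With two holes a pair with sure loss indeed exists, already on the grid of size nine and with
  integer values: the tables \<open>P\<^sub>9\<close> and \<open>Q\<^sub>9\<close> below. For every copula \<open>C\<close> between them
  the rectangle \<open>[2,7] \<times> [1,6]\<close> has mass at most 1, but its disjoint subrectangles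
  \<open>[3,6] \<times> [2,3]\<close> and \<open>[4,5] \<times> [4,5]\<close> have mass at least 1 each.

  Self-duality says that the inequalities are as tight as possible. They give
  \<open>P\<^sub>M \<le> Q\<close> and \<open>P \<le> Q\<^sub>O\<close>, and equality holds if every grid point where \<open>P\<close> and \<open>Q\<close> differ is a
  corner, of each of the two kinds, of a rectangle for which the relevant inequality is an
  equality (\<open>corner_tight\<close>, \<open>self_dual_if_corner_tight\<close>). For the tables a short list of rectangles
  serves all these points.

  Larger grids are reached by a direct sum: the pair is kept on the initial square and
  continued by the minimum copula. The added mass lies on the diagonal and is
  nonnegative, so the inequalities persist; the pair is unchanged on the initial square and
  coincides with the minimum outside, so neither tightness nor the sure loss is affected.
\<close>

section \<open>Consequences of the imprecise copula inequalities\<close>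

lemma V_additive_columns: "V F (i, j, k, m) = V F (i, j, k, l) + V F (i, j, l, m)"
  by simp

lemma copula_V_nonneg:
  assumes "discrete_copula n C" "i \<le> j" "j \<le> n" "k \<le> l" "l \<le> n"
  shows "0 \<le> V C (i, j, k, l)"
proof -
  have "C i k + C j l \<ge> C i l + C j k"
    using assms unfolding discrete_copula_def by auto
  then show ?thesis by simp
qed

text \<open>The larger rectangle is the smaller one together with four rectangles around it.\<close>

lemma copula_V_mono:
  assumes C: "discrete_copula n C"
    and rows: "i \<le> i'" "i' \<le> j'" "j' \<le> j" "j \<le> n"
    and cols: "k \<le> k'" "k' \<le> l'" "l' \<le> l" "l \<le> n"
  shows "V C (i', j', k', l') \<le> V C (i, j, k, l)"
proof -
  have "V C (i, j, k, l) = V C (i', j', k', l') + V C (i, j, k, k') + V C (i, j, l', l)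
      + V C (i, i', k', l') + V C (j', j, k', l')"
    by simp
  moreover have "0 \<le> V C (i, j, k, k')" "0 \<le> V C (i, j, l', l)"
      "0 \<le> V C (i, i', k', l')" "0 \<le> V C (j', j, k', l')"
    by (rule copula_V_nonneg[OF C]; use rows cols in linarith)+
  ultimately show ?thesis by linarith
qed

text \<open>
  Where a rectangle meets the boundary of the grid, \<open>P\<close> and \<open>Q\<close> agree at enough of its corners
  to turn one of the four mixed inequalities into the inequality for \<open>P\<close> alone, and another
  one into the inequality for \<open>Q\<close> alone.
\<close>

lemma imprecise_copula_imp_quasi_copula:
  assumes "discrete_imprecise_copula n P Q"
  shows "discrete_quasi_copula n P" and "discrete_quasi_copula n Q"
proof -
  have gP: "grid_function n P" and gQ: "grid_function n Q"
    and bP: "boundary_condition n P" and bQ: "boundary_condition n Q"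
    using assms unfolding discrete_imprecise_copula_def by auto
  have bd: "P i k = Q i k" if "i \<le> n" "k \<le> n" "i = 0 \<or> k = 0 \<or> i = n \<or> k = n" for i k
    using bP bQ that unfolding boundary_condition_def by auto
  have ic: "Q i k + P j l \<ge> P i l + P j k" "P i k + Q j l \<ge> P i l + P j k"
      "Q i k + Q j l \<ge> Q i l + P j k" "Q i k + Q j l \<ge> P i l + Q j k"
    if "i \<le> j" "j \<le> n" "k \<le> l" "l \<le> n" for i j k l
    using assms that unfolding discrete_imprecise_copula_def
    by (smt (verit))+
  have cases: "P x1 y1 + P x2 y2 \<ge> P x1 y2 + P x2 y1 \<and> Q x1 y1 + Q x2 y2 \<ge> Q x1 y2 + Q x2 y1"
    if le: "x1 \<le> x2" "x2 \<le> n" "y1 \<le> y2" "y2 \<le> n"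
      and hit: "{x1, x2, y1, y2} \<inter> {0, n} \<noteq> {}" for x1 x2 y1 y2
  proof -
    consider "x1 = 0 \<or> y1 = 0" | "x2 = n \<or> y2 = n" | "x1 = x2 \<or> y1 = y2"
      using hit le by fastforce
    then show ?thesis
    proof cases
      case 1
      then have "P x1 y1 = Q x1 y1" "P x1 y2 = Q x1 y2 \<or> P x2 y1 = Q x2 y1"
        using bd le by auto
      then show ?thesis using ic[OF le] by linarith
    next
      case 2
      then have "P x2 y2 = Q x2 y2" "P x1 y2 = Q x1 y2 \<or> P x2 y1 = Q x2 y1"
        using bd le by auto
      then show ?thesis using ic[OF le] by linarith
    qed auto
  qed
  show "discrete_quasi_copula n P" "discrete_quasi_copula n Q"
    unfolding discrete_quasi_copula_def using gP gQ bP bQ cases by auto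
qed

section \<open>Self-duality as tightness of the inequalities\<close>

lemma rects_by_opposite_corner:
  assumes "r \<le> n" "s \<le> n"
  shows rects_SE_iff: "R \<in> rects_SE n r s \<longleftrightarrow> (\<exists>i\<in>{r<..n}. \<exists>j\<in>{s<..n}. R = (r, i, s, j))"
    and rects_SW_iff: "R \<in> rects_SW n r s \<longleftrightarrow> (\<exists>i\<in>{r<..n}. \<exists>j\<in>{1..s}. R = (r, i, j, s))"
    and rects_NW_iff: "R \<in> rects_NW n r s \<longleftrightarrow> (\<exists>i\<in>{1..r}. \<exists>j\<in>{1..s}. R = (i, r, j, s))"
    and rects_NE_iff: "R \<in> rects_NE n r s \<longleftrightarrow> (\<exists>i\<in>{1..r}. \<exists>j\<in>{s<..n}. R = (i, r, s, j))"
proof -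
  have shift: "(\<exists>i\<in>{1..n - t}. \<Phi> (t + i)) \<longleftrightarrow> (\<exists>i\<in>{t<..n}. \<Phi> i)" if "t \<le> n" for t \<Phi>
  proof
    assume "\<exists>i\<in>{t<..n}. \<Phi> i"
    then obtain i where "t < i" "i \<le> n" "\<Phi> i" by auto
    then show "\<exists>i\<in>{1..n - t}. \<Phi> (t + i)"
      by (intro bexI[of _ "i - t"]) auto
  qed (use that in force)
  show "R \<in> rects_SE n r s \<longleftrightarrow> (\<exists>i\<in>{r<..n}. \<exists>j\<in>{s<..n}. R = (r, i, s, j))"
    unfolding shift[OF assms(1), symmetric] shift[OF assms(2), symmetric]
    by (auto simp: rects_SE_def)
  show "R \<in> rects_SW n r s \<longleftrightarrow> (\<exists>i\<in>{r<..n}. \<exists>j\<in>{1..s}. R = (r, i, j, s))"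
    unfolding shift[OF assms(1), symmetric] by (auto simp: rects_SW_def)
  show "R \<in> rects_NW n r s \<longleftrightarrow> (\<exists>i\<in>{1..r}. \<exists>j\<in>{1..s}. R = (i, r, j, s))"
    by (auto simp: rects_NW_def)
  show "R \<in> rects_NE n r s \<longleftrightarrow> (\<exists>i\<in>{1..r}. \<exists>j\<in>{s<..n}. R = (i, r, s, j))"
    unfolding shift[OF assms(2), symmetric] by (auto simp: rects_NE_def)
qed

lemma finite_rects:
  assumes "r \<le> n" "s \<le> n"
  shows "finite (rects_SE n r s)" "finite (rects_SW n r s)"
    "finite (rects_NW n r s)" "finite (rects_NE n r s)"
proof -
  let ?B = "{..n} \<times> {..n} \<times> {..n} \<times> {..n}"
  have fin: "finite ?B" by simp
  have sub: "rects_SE n r s \<subseteq> ?B" "rects_SW n r s \<subseteq> ?B"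
    "rects_NW n r s \<subseteq> ?B" "rects_NE n r s \<subseteq> ?B"
    using assms by (auto simp: rects_by_opposite_corner[OF assms])
  show "finite (rects_SE n r s)" "finite (rects_SW n r s)"
    "finite (rects_NW n r s)" "finite (rects_NE n r s)"
    by (rule finite_subset[OF _ fin], rule sub)+
qed

lemma min_defect_eqI:
  assumes fin: "finite (\<R> n r s)" "finite (\<S> n r s)" and "c \<le> 0"
    and ge: "\<And>R. R \<in> \<R> n r s \<union> \<S> n r s \<Longrightarrow> c \<le> V F R"
    and attained: "c = 0 \<or> (\<exists>R\<in>\<R> n r s \<union> \<S> n r s. V F R = c)"
  shows "min (defect \<R> n F r s) (defect \<S> n F r s) = c"
proof -
  have "min (defect \<R> n F r s) (defect \<S> n F r s)
      = Min (({0} \<union> V F ` \<R> n r s) \<union> ({0} \<union> V F ` \<S> n r s))"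
    unfolding defect_def using fin by (subst Min_Un) (auto simp: min_def)
  also have "\<dots> = c"
    using assms by (intro Min_eqI) auto
  finally show ?thesis .
qed

text \<open>
  The first disjunction is equality in one of the first two inequalities of an imprecise copula,
  with \<open>(r, s)\<close> as the corner that carries the value of \<open>Q\<close>; the second one is equality in one of
  the last two, with \<open>(r, s)\<close> as the corner that carries the value of \<open>P\<close>.
\<close>

definition corner_tight ::
    "nat \<Rightarrow> (nat \<Rightarrow> nat \<Rightarrow> real) \<Rightarrow> (nat \<Rightarrow> nat \<Rightarrow> real) \<Rightarrow> bool" where
  "corner_tight n P Q \<longleftrightarrow> (\<forall>r\<in>L n. \<forall>s\<in>L n. P r s \<noteq> Q r s \<longrightarrow>
     ((\<exists>i\<in>{r<..n}. \<exists>j\<in>{s<..n}. Q r s + P i j = P r j + P i s) \<or>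
      (\<exists>i\<in>{1..r}. \<exists>j\<in>{1..s}. P i j + Q r s = P i s + P r j)) \<and>
     ((\<exists>i\<in>{r<..n}. \<exists>j\<in>{1..s}. Q r j + Q i s = P r s + Q i j) \<or>
      (\<exists>i\<in>{1..r}. \<exists>j\<in>{s<..n}. Q i s + Q r j = Q i j + P r s)))"

text \<open>
  Solved for the value at one corner, the four inequalities bound the volumes of the rectangles
  in each of the four directions below by \<open>P r s - Q r s\<close>: those of \<open>P\<close> towards the south-east and
  north-west, those of \<open>Q\<close> towards the south-west and north-east. Tightness says that the bound is
  attained, hence both defects equal \<open>P r s - Q r s\<close>.
\<close>

lemma self_dual_if_corner_tight:
  assumes ic: "discrete_imprecise_copula n P Q" and tight: "corner_tight n P Q"
  shows "self_dual n P Q"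
proof -
  have ineq: "Q i k + P j l \<ge> P i l + P j k" "P i k + Q j l \<ge> P i l + P j k"
      "Q i k + Q j l \<ge> Q i l + P j k" "Q i k + Q j l \<ge> P i l + Q j k"
    if "i \<le> j" "j \<le> n" "k \<le> l" "l \<le> n" for i j k l
    using ic that unfolding discrete_imprecise_copula_def by (smt (verit))+
  have defects: "D_M n P r s = P r s - Q r s \<and> D_O n Q r s = P r s - Q r s"
    if rs: "r \<le> n" "s \<le> n" for r s
  proof
    note rects = rects_by_opposite_corner[OF rs]
    note tight_at = tight[unfolded corner_tight_def, rule_format, of r s]
    have le: "P r s - Q r s \<le> 0"
      using ineq(1)[of r r s s] rs by simp
    show "D_M n P r s = P r s - Q r s"
      unfolding D_M_def
    proof (rule min_defect_eqI)
      show "finite (rects_SE n r s)" "finite (rects_NW n r s)"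
        using finite_rects[OF rs] by blast+
      show "P r s - Q r s \<le> 0" by (rule le)
    next
      fix R assume "R \<in> rects_SE n r s \<union> rects_NW n r s"
      then consider i j where "i \<in> {r<..n}" "j \<in> {s<..n}" "R = (r, i, s, j)"
        | i j where "i \<in> {1..r}" "j \<in> {1..s}" "R = (i, r, j, s)"
        by (auto simp: rects)
      then show "P r s - Q r s \<le> V P R"
      proof cases
        case 1
        then show ?thesis using ineq(1)[of r i s j] rs by simp
      next
        case 2
        then show ?thesis using ineq(2)[of i r j s] rs by simp
      qed
    next
      show "P r s - Q r s = 0 \<or> (\<exists>R\<in>rects_SE n r s \<union> rects_NW n r s. V P R = P r s - Q r s)"
      proof (cases "P r s = Q r s")
        case False
        then consider i j where "i \<in> {r<..n}" "j \<in> {s<..n}" "Q r s + P i j = P r j + P i s"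
          | i j where "i \<in> {1..r}" "j \<in> {1..s}" "P i j + Q r s = P i s + P r j"
          using tight_at[THEN conjunct1] rs False by auto
        then show ?thesis
        proof cases
          case 1
          then have "(r, i, s, j) \<in> rects_SE n r s" "V P (r, i, s, j) = P r s - Q r s"
            by (auto simp: rects)
          then show ?thesis by blast
        next
          case 2
          then have "(i, r, j, s) \<in> rects_NW n r s" "V P (i, r, j, s) = P r s - Q r s"
            by (auto simp: rects)
          then show ?thesis by blast
        qed
      qed simp
    qed
    show "D_O n Q r s = P r s - Q r s"
      unfolding D_O_def
    proof (rule min_defect_eqI)
      show "finite (rects_SW n r s)" "finite (rects_NE n r s)"
        using finite_rects[OF rs] by blast+
      show "P r s - Q r s \<le> 0" by (rule le)
    next
      fix R assume "R \<in> rects_SW n r s \<union> rects_NE n r s"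
      then consider i j where "i \<in> {r<..n}" "j \<in> {1..s}" "R = (r, i, j, s)"
        | i j where "i \<in> {1..r}" "j \<in> {s<..n}" "R = (i, r, s, j)"
        by (auto simp: rects)
      then show "P r s - Q r s \<le> V Q R"
      proof cases
        case 1
        then show ?thesis using ineq(4)[of r i j s] rs by simp
      next
        case 2
        then show ?thesis using ineq(3)[of i r s j] rs by simp
      qed
    next
      show "P r s - Q r s = 0 \<or> (\<exists>R\<in>rects_SW n r s \<union> rects_NE n r s. V Q R = P r s - Q r s)"
      proof (cases "P r s = Q r s")
        case False
        then consider i j where "i \<in> {r<..n}" "j \<in> {1..s}" "Q r j + Q i s = P r s + Q i j"
          | i j where "i \<in> {1..r}" "j \<in> {s<..n}" "Q i s + Q r j = Q i j + P r s"
          using tight_at[THEN conjunct2] rs False by auto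
        then show ?thesis
        proof cases
          case 1
          then have "(r, i, j, s) \<in> rects_SW n r s" "V Q (r, i, j, s) = P r s - Q r s"
            by (auto simp: rects)
          then show ?thesis by blast
        next
          case 2
          then have "(i, r, s, j) \<in> rects_NE n r s" "V Q (i, r, s, j) = P r s - Q r s"
            by (auto simp: rects)
          then show ?thesis by blast
        qed
      qed simp
    qed
  qed
  have "main_transform n P r s = Q r s \<and> opposite_transform n Q r s = P r s"
    if "r \<in> L n" "s \<in> L n" for r s
    using defects[of r s] that
    unfolding main_transform_def opposite_transform_def by auto
  then show ?thesis
    unfolding self_dual_def by blast
qed

lemma minimal_rangeI:
  assumes "grid_function n F" "boundary_condition n F"
    and nat: "\<And>r s. r \<le> n \<Longrightarrow> s \<le> n \<Longrightarrow> F r s \<in> \<nat>"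
  shows "minimal_range n F"
  unfolding minimal_range_def
proof
  show "(\<lambda>(r, s). F r s) ` (L n \<times> L n) \<subseteq> real ` L n"
  proof clarify
    fix r s assume rs: "r \<in> L n" "s \<in> L n"
    then have "F r s \<in> \<nat>" using nat by simp
    then obtain k where "F r s = real k" by (rule Nats_cases)
    moreover have "F r s \<le> real n" using assms(1) rs by (auto simp: grid_function_def)
    ultimately show "F r s \<in> real ` L n"
      by (intro image_eqI[where x = k]) simp_all
  qed
  show "real ` L n \<subseteq> (\<lambda>(r, s). F r s) ` (L n \<times> L n)"
  proof
    fix x assume "x \<in> real ` L n"
    then obtain r where "r \<in> L n" "x = real r" by blast
    then have "x = F r n"
      using assms(2) by (simp add: boundary_condition_def)
    then show "x \<in> (\<lambda>(r, s). F r s) ` (L n \<times> L n)"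
      using \<open>r \<in> L n\<close> by (intro image_eqI[of _ _ "(r, n)"]) auto
  qed
qed

section \<open>Direct sums with the minimum\<close>

text \<open>
  The ordinal sum of \<open>F\<close> on the initial square with the minimum copula on the rest, in one
  formula: if \<open>r > m\<close> or \<open>s > m\<close>, the first summand is the boundary value \<open>min (min r m) (min s m)\<close>,
  and the second one vanishes unless both coordinates exceed \<open>m\<close>. Written as a sum, it inherits
  the linear inequalities from its summands.
\<close>

definition direct_sum_min :: "nat \<Rightarrow> (nat \<Rightarrow> nat \<Rightarrow> real) \<Rightarrow> nat \<Rightarrow> nat \<Rightarrow> real" where
  "direct_sum_min m F r s = F (min r m) (min s m) + real (min (r - m) (s - m))"

lemma direct_sum_min_inner [simp]:
  "r \<le> m \<Longrightarrow> s \<le> m \<Longrightarrow> direct_sum_min m F r s = F r s"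
  by (simp add: direct_sum_min_def)

lemma direct_sum_min_outer:
  assumes "boundary_condition m F" "m \<le> r \<or> m \<le> s"
  shows "direct_sum_min m F r s = real (min r s)"
  using assms by (auto simp: direct_sum_min_def boundary_condition_def min_def)

lemma direct_sum_min_boundary:
  assumes "boundary_condition m F" "m \<le> n"
  shows "boundary_condition n (direct_sum_min m F)"
proof -
  have "direct_sum_min m F r 0 = 0" "direct_sum_min m F 0 r = 0" for r
    using assms(1) by (auto simp: direct_sum_min_def boundary_condition_def)
  then show ?thesis
    using assms by (simp add: boundary_condition_def direct_sum_min_outer)
qed

lemma quasi_copula_le_row:
  assumes "discrete_quasi_copula n F" "r \<le> n" "s \<le> n"
  shows "F r s \<le> real r"
proof -
  have bd: "F 0 s = 0" "F 0 n = 0" "F r n = real r"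
    using assms unfolding discrete_quasi_copula_def boundary_condition_def by auto
  have "F 0 s + F r n \<ge> F 0 n + F r s"
    using assms unfolding discrete_quasi_copula_def by auto
  then show ?thesis using bd by simp
qed

lemma direct_sum_min_grid_function:
  assumes "discrete_quasi_copula m F"
  shows "grid_function n (direct_sum_min m F)"
  unfolding grid_function_def
proof (intro ballI)
  fix r s assume r: "r \<in> L n" and "s \<in> L n"
  have "0 \<le> F (min r m) (min s m)"
    using assms unfolding discrete_quasi_copula_def grid_function_def by auto
  moreover have "F (min r m) (min s m) \<le> real (min r m)"
    using quasi_copula_le_row[OF assms] by simp
  moreover have "real (min r m) + real (min (r - m) (s - m)) \<le> real n"
    using r by (simp flip: of_nat_add)
  ultimately show "0 \<le> direct_sum_min m F r s \<and> direct_sum_min m F r s \<le> real n"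
    unfolding direct_sum_min_def by linarith
qed

lemma min_two_increasing:
  fixes i j k l :: nat
  assumes "i \<le> j" "k \<le> l"
  shows "min i l + min j k \<le> min i k + min j l"
  using assms by (auto simp: min_def)

lemma direct_sum_min_imprecise_copula:
  assumes ic: "discrete_imprecise_copula m P Q" and "m \<le> n"
  shows "discrete_imprecise_copula n (direct_sum_min m P) (direct_sum_min m Q)"
proof -
  let ?P = "direct_sum_min m P" and ?Q = "direct_sum_min m Q"
  define p where "p i k = P (min i m) (min k m)" for i k
  define q where "q i k = Q (min i m) (min k m)" for i k
  define d where "d i k = real (min (i - m) (k - m))" for i k
  have split: "?P i k = p i k + d i k" "?Q i k = q i k + d i k" for i k
    by (simp_all add: direct_sum_min_def p_def q_def d_def)
  have ineq: "?Q i k + ?P j l - ?P i l - ?P j k \<ge> 0 \<and> ?P i k + ?Q j l - ?P i l - ?P j k \<ge> 0 \<and>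
      ?Q i k + ?Q j l - ?Q i l - ?P j k \<ge> 0 \<and> ?Q i k + ?Q j l - ?P i l - ?Q j k \<ge> 0"
    if le: "i \<le> j" "k \<le> l" for i j k l
  proof -
    have "min i m \<le> min j m" "min j m \<le> m" "min k m \<le> min l m" "min l m \<le> m"
      using le by auto
    then have "q i k + p j l - p i l - p j k \<ge> 0 \<and> p i k + q j l - p i l - p j k \<ge> 0 \<and>
        q i k + q j l - q i l - p j k \<ge> 0 \<and> q i k + q j l - p i l - q j k \<ge> 0"
      using ic unfolding discrete_imprecise_copula_def p_def q_def by blast
    moreover have "d i l + d j k \<le> d i k + d j l"
      using min_two_increasing[of "i - m" "j - m" "k - m" "l - m"] le
      unfolding d_def by (simp only: diff_le_mono of_nat_add[symmetric] of_nat_le_iff)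
    ultimately show ?thesis
      unfolding split by linarith
  qed
  have "boundary_condition m P" "boundary_condition m Q"
    using ic unfolding discrete_imprecise_copula_def by auto
  then have "boundary_condition n ?P" "boundary_condition n ?Q"
    using direct_sum_min_boundary \<open>m \<le> n\<close> by blast+
  moreover have "grid_function n ?P" "grid_function n ?Q"
    using imprecise_copula_imp_quasi_copula[OF ic] direct_sum_min_grid_function by blast+
  ultimately show ?thesis
    unfolding discrete_imprecise_copula_def using ineq by simp
qed

lemma direct_sum_min_corner_tight:
  assumes tight: "corner_tight m P Q" and "m \<le> n"
    and bd: "boundary_condition m P" "boundary_condition m Q"
  shows "corner_tight n (direct_sum_min m P) (direct_sum_min m Q)"
  unfolding corner_tight_def
proof (intro ballI impI)
  let ?P = "direct_sum_min m P" and ?Q = "direct_sum_min m Q"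
  fix r s assume "r \<in> L n" "s \<in> L n" and ne: "?P r s \<noteq> ?Q r s"
  then have rs: "r \<le> m" "s \<le> m"
    using bd by (metis direct_sum_min_outer nle_le)+
  then have "P r s \<noteq> Q r s" using ne by simp
  then have
    "((\<exists>i\<in>{r<..m}. \<exists>j\<in>{s<..m}. Q r s + P i j = P r j + P i s) \<or>
      (\<exists>i\<in>{1..r}. \<exists>j\<in>{1..s}. P i j + Q r s = P i s + P r j)) \<and>
     ((\<exists>i\<in>{r<..m}. \<exists>j\<in>{1..s}. Q r j + Q i s = P r s + Q i j) \<or>
      (\<exists>i\<in>{1..r}. \<exists>j\<in>{s<..m}. Q i s + Q r j = Q i j + P r s))"
    using tight rs unfolding corner_tight_def by auto
  then have
    "((\<exists>i\<in>{r<..m}. \<exists>j\<in>{s<..m}. ?Q r s + ?P i j = ?P r j + ?P i s) \<or>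
      (\<exists>i\<in>{1..r}. \<exists>j\<in>{1..s}. ?P i j + ?Q r s = ?P i s + ?P r j)) \<and>
     ((\<exists>i\<in>{r<..m}. \<exists>j\<in>{1..s}. ?Q r j + ?Q i s = ?P r s + ?Q i j) \<or>
      (\<exists>i\<in>{1..r}. \<exists>j\<in>{s<..m}. ?Q i s + ?Q r j = ?Q i j + ?P r s))"
    using rs by simp
  moreover have "{t<..m} \<subseteq> {t<..n}" for t using \<open>m \<le> n\<close> by auto
  ultimately show
    "((\<exists>i\<in>{r<..n}. \<exists>j\<in>{s<..n}. ?Q r s + ?P i j = ?P r j + ?P i s) \<or>
      (\<exists>i\<in>{1..r}. \<exists>j\<in>{1..s}. ?P i j + ?Q r s = ?P i s + ?P r j)) \<and>
     ((\<exists>i\<in>{r<..n}. \<exists>j\<in>{1..s}. ?Q r j + ?Q i s = ?P r s + ?Q i j) \<or>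
      (\<exists>i\<in>{1..r}. \<exists>j\<in>{s<..n}. ?Q i s + ?Q r j = ?Q i j + ?P r s))"
    by blast
qed

lemma direct_sum_min_Nats:
  "(\<And>r s. F r s \<in> \<nat>) \<Longrightarrow> direct_sum_min m F r s \<in> \<nat>"
  by (simp add: direct_sum_min_def)

section \<open>A pair on the grid of size nine\<close>

text \<open>
  The tables are an integral solution of the linear program whose constraints are the
  boundary conditions, the inequalities of an imprecise copula, and a negative favourable
  evaluation of the region \<open>[2,7] \<times> [1,6]\<close> with the holes \<open>[3,6] \<times> [2,3]\<close> and \<open>[4,5] \<times> [4,5]\<close>. Applying
  first the main and then the opposite transform to the lower table of a solution yields a
  self-dual pair inside the old bounds, so that self-duality need not be a constraint.
\<close>

definition P_rows :: "nat list list" where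
  "P_rows =
    [[0, 0, 0, 0, 0, 0, 0, 0, 0, 0],
     [0, 0, 0, 0, 0, 0, 1, 1, 1, 1],
     [0, 0, 0, 0, 1, 1, 2, 2, 2, 2],
     [0, 0, 1, 1, 1, 1, 2, 2, 2, 3],
     [0, 0, 1, 1, 2, 2, 2, 2, 3, 4],
     [0, 0, 1, 1, 2, 3, 3, 3, 4, 5],
     [0, 0, 1, 2, 2, 3, 3, 4, 5, 6],
     [0, 1, 1, 2, 2, 3, 4, 5, 6, 7],
     [0, 1, 1, 2, 3, 4, 5, 6, 7, 8],
     [0, 1, 2, 3, 4, 5, 6, 7, 8, 9]]"

definition Q_rows :: "nat list list" where
  "Q_rows =
    [[0, 0, 0, 0, 0, 0, 0, 0, 0, 0],
     [0, 0, 0, 0, 1, 1, 1, 1, 1, 1],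
     [0, 0, 1, 1, 2, 2, 2, 2, 2, 2],
     [0, 1, 1, 1, 2, 2, 3, 3, 3, 3],
     [0, 1, 1, 2, 2, 2, 3, 3, 3, 4],
     [0, 1, 1, 2, 2, 3, 4, 4, 4, 5],
     [0, 1, 1, 2, 3, 4, 4, 4, 5, 6],
     [0, 1, 2, 3, 3, 4, 4, 5, 6, 7],
     [0, 1, 2, 3, 3, 4, 5, 6, 7, 8],
     [0, 1, 2, 3, 4, 5, 6, 7, 8, 9]]"

definition P\<^sub>9 :: "nat \<Rightarrow> nat \<Rightarrow> nat" where "P\<^sub>9 r s = P_rows ! r ! s"
definition Q\<^sub>9 :: "nat \<Rightarrow> nat \<Rightarrow> nat" where "Q\<^sub>9 r s = Q_rows ! r ! s"

lemma table_row: "P\<^sub>9 r = (!) (P_rows ! r)" "Q\<^sub>9 r = (!) (Q_rows ! r)"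
  by (simp_all add: P\<^sub>9_def Q\<^sub>9_def fun_eq_iff)

lemmas row_instances = table_row[of 0] table_row[of 1] table_row[of 2] table_row[of 3] table_row[of 4]
  table_row[of 5] table_row[of 6] table_row[of 7] table_row[of 8] table_row[of 9]

lemmas lookup = row_instances[unfolded P_rows_def Q_rows_def, simplified]

lemma below_10: "(\<forall>t<10. \<Phi> t) \<longleftrightarrow>
    \<Phi> 0 \<and> \<Phi> (Suc 0) \<and> \<Phi> 2 \<and> \<Phi> 3 \<and> \<Phi> 4 \<and> \<Phi> 5 \<and> \<Phi> 6 \<and> \<Phi> 7 \<and> \<Phi> 8 \<and> \<Phi> 9" for \<Phi> :: "nat \<Rightarrow> bool"
  by (auto simp: eval_nat_numeral All_less_Suc)

lemma table_boundary:
  "\<forall>t<10. P\<^sub>9 t 0 = 0 \<and> P\<^sub>9 0 t = 0 \<and> P\<^sub>9 t 9 = t \<and> P\<^sub>9 9 t = t \<and>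
    Q\<^sub>9 t 0 = 0 \<and> Q\<^sub>9 0 t = 0 \<and> Q\<^sub>9 t 9 = t \<and> Q\<^sub>9 9 t = t"
  unfolding below_10 by (simp add: lookup)

lemma table_bounds: "\<forall>r<10. \<forall>s<10. P\<^sub>9 r s \<le> Q\<^sub>9 r s \<and> Q\<^sub>9 r s \<le> r"
  unfolding below_10 by (simp add: lookup)

text \<open>
  To check the inequalities without looking up entries, two rows of both tables are read
  as a list of columns, each column being the four entries \<open>P i k\<close>, \<open>Q i k\<close>, \<open>P j k\<close>, \<open>Q j k\<close>.
  The inequalities then relate any two columns of this list, and \<^const>\<open>sorted_wrt\<close> ranges over
  all pairs of rows as well as over all pairs of columns.
\<close>

definition column_ineqs :: "nat \<times> nat \<times> nat \<times> nat \<Rightarrow> nat \<times> nat \<times> nat \<times> nat \<Rightarrow> bool" where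
  "column_ineqs = (\<lambda>(p, q, p', q') (u, v, u', v').
     u + p' \<le> q + u' \<and> u + p' \<le> p + v' \<and> v + p' \<le> q + v' \<and> u + q' \<le> q + v')"

definition row_ineqs :: "nat list \<times> nat list \<Rightarrow> nat list \<times> nat list \<Rightarrow> bool" where
  "row_ineqs = (\<lambda>(ps, qs) (ps', qs').
     sorted_wrt column_ineqs (zip ps (zip qs (zip ps' qs'))))"

lemma rows_sorted: "sorted_wrt row_ineqs (zip P_rows Q_rows)"
  by (simp add: P_rows_def Q_rows_def row_ineqs_def column_ineqs_def)

text \<open>
  The tables differ by at most 1. So a rectangle of \<open>P\<^sub>9\<close>-volume \<open>-1\<close> makes the inequality tight at
  both of its main corners, if the tables differ there, and a rectangle of \<open>Q\<^sub>9\<close>-volume \<open>-1\<close> does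
  so at its two opposite corners. The following lists, found by a greedy cover, reach every
  point where the tables differ.
\<close>

definition main_witnesses :: "rect list" where
  "main_witnesses =
    [(1, 4, 4, 6), (1, 5, 5, 6), (2, 3, 2, 6), (2, 3, 3, 4), (2, 3, 3, 7), (2, 3, 3, 8),
     (2, 4, 4, 6), (2, 4, 5, 7), (3, 4, 5, 6), (3, 5, 5, 7), (3, 6, 5, 6), (3, 7, 1, 2),
     (4, 7, 1, 2), (4, 7, 3, 4), (5, 6, 3, 4), (5, 6, 3, 5), (5, 7, 3, 5), (5, 8, 1, 2),
     (6, 7, 1, 2), (6, 7, 1, 3), (6, 8, 1, 3)]"

definition opposite_witnesses :: "rect list" where
  "opposite_witnesses =
    [(1, 4, 3, 5), (1, 8, 3, 4), (2, 3, 1, 2), (2, 3, 1, 3), (2, 4, 1, 5), (2, 5, 1, 2),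
     (2, 5, 3, 4), (2, 6, 1, 2), (3, 4, 3, 4), (3, 4, 3, 5), (3, 4, 3, 6), (3, 4, 3, 7),
     (3, 4, 3, 8), (4, 6, 5, 7), (4, 7, 5, 6), (5, 6, 5, 6), (5, 6, 5, 7), (5, 7, 4, 6),
     (6, 7, 2, 6), (6, 7, 3, 4), (6, 8, 2, 4)]"

lemma witnesses_in_grid:
  "\<forall>(i, j, k, l)\<in>set main_witnesses \<union> set opposite_witnesses.
    1 \<le> i \<and> i < j \<and> j \<le> 9 \<and> 1 \<le> k \<and> k < l \<and> l \<le> 9"
  by (simp add: main_witnesses_def opposite_witnesses_def)

lemma main_witnesses_defect:
  "\<forall>(i, j, k, l)\<in>set main_witnesses. P\<^sub>9 i k + P\<^sub>9 j l + 1 = P\<^sub>9 i l + P\<^sub>9 j k"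
  by (simp add: main_witnesses_def lookup)

lemma opposite_witnesses_defect:
  "\<forall>(i, j, k, l)\<in>set opposite_witnesses. Q\<^sub>9 i k + Q\<^sub>9 j l + 1 = Q\<^sub>9 i l + Q\<^sub>9 j k"
  by (simp add: opposite_witnesses_def lookup)

lemma gaps_at_witnesses:
  "\<forall>r<10. \<forall>s<10. P\<^sub>9 r s = Q\<^sub>9 r s \<or> Q\<^sub>9 r s = P\<^sub>9 r s + 1 \<and>
    (\<exists>(i, j, k, l)\<in>set main_witnesses. (r, s) = (i, k) \<or> (r, s) = (j, l)) \<and>
    (\<exists>(i, j, k, l)\<in>set opposite_witnesses. (r, s) = (i, l) \<or> (r, s) = (j, k))"
  unfolding below_10
  by (simp add: main_witnesses_def opposite_witnesses_def lookup)

lemma table_ineqs: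
  assumes "i < j" "j < 10" "k < l" "l < 10"
  shows "P\<^sub>9 i l + P\<^sub>9 j k \<le> Q\<^sub>9 i k + P\<^sub>9 j l" "P\<^sub>9 i l + P\<^sub>9 j k \<le> P\<^sub>9 i k + Q\<^sub>9 j l"
    "Q\<^sub>9 i l + P\<^sub>9 j k \<le> Q\<^sub>9 i k + Q\<^sub>9 j l" "P\<^sub>9 i l + Q\<^sub>9 j k \<le> Q\<^sub>9 i k + Q\<^sub>9 j l"
proof -
  have len: "length P_rows = 10" "length Q_rows = 10"
    by (simp_all add: P_rows_def Q_rows_def)
  have "\<forall>row\<in>set P_rows \<union> set Q_rows. length row = 10"
    by (simp add: P_rows_def Q_rows_def)
  then have len_row: "length (P_rows ! t) = 10" "length (Q_rows ! t) = 10" if "t < 10" for t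
    using that len by simp_all
  have "row_ineqs (P_rows ! i, Q_rows ! i) (P_rows ! j, Q_rows ! j)"
    using rows_sorted assms by (simp add: sorted_wrt_iff_nth_less len)
  then have "column_ineqs (P\<^sub>9 i k, Q\<^sub>9 i k, P\<^sub>9 j k, Q\<^sub>9 j k) (P\<^sub>9 i l, Q\<^sub>9 i l, P\<^sub>9 j l, Q\<^sub>9 j l)"
    using assms by (simp add: row_ineqs_def sorted_wrt_iff_nth_less len_row P\<^sub>9_def Q\<^sub>9_def)
  then show "P\<^sub>9 i l + P\<^sub>9 j k \<le> Q\<^sub>9 i k + P\<^sub>9 j l" "P\<^sub>9 i l + P\<^sub>9 j k \<le> P\<^sub>9 i k + Q\<^sub>9 j l"
    "Q\<^sub>9 i l + P\<^sub>9 j k \<le> Q\<^sub>9 i k + Q\<^sub>9 j l" "P\<^sub>9 i l + Q\<^sub>9 j k \<le> Q\<^sub>9 i k + Q\<^sub>9 j l"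
    unfolding column_ineqs_def by simp_all
qed

abbreviation \<P> :: "nat \<Rightarrow> nat \<Rightarrow> real" where "\<P> r s \<equiv> real (P\<^sub>9 r s)"
abbreviation \<Q> :: "nat \<Rightarrow> nat \<Rightarrow> real" where "\<Q> r s \<equiv> real (Q\<^sub>9 r s)"

lemma table_imprecise_copula: "discrete_imprecise_copula 9 \<P> \<Q>"
proof -
  have bounds: "P\<^sub>9 r s \<le> Q\<^sub>9 r s" "Q\<^sub>9 r s \<le> r" if "r \<le> 9" "s \<le> 9" for r s
    using table_bounds that by auto
  have "P\<^sub>9 r s \<le> 9" "Q\<^sub>9 r s \<le> 9" if "r \<le> 9" "s \<le> 9" for r s
    using bounds[OF that] that by linarith+
  then have "grid_function 9 \<P>" "grid_function 9 \<Q>"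
    unfolding grid_function_def by auto
  moreover have "boundary_condition 9 \<P>" "boundary_condition 9 \<Q>"
    using table_boundary unfolding boundary_condition_def by auto
  moreover have "\<Q> i k + \<P> j l - \<P> i l - \<P> j k \<ge> 0 \<and> \<P> i k + \<Q> j l - \<P> i l - \<P> j k \<ge> 0 \<and>
      \<Q> i k + \<Q> j l - \<Q> i l - \<P> j k \<ge> 0 \<and> \<Q> i k + \<Q> j l - \<P> i l - \<Q> j k \<ge> 0"
    if le: "i \<le> j" "j \<le> 9" "k \<le> l" "l \<le> 9" for i j k l
  proof (cases "i < j \<and> k < l")
    case True
    then show ?thesis
      using table_ineqs[of i j k l, THEN of_nat_mono[where 'a = real]] le by simp
  next
    case False
    then have "i = j \<or> k = l" using le by auto
    moreover have "\<P> i k \<le> \<Q> i k" "\<P> j l \<le> \<Q> j l"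
      using bounds(1) le by simp_all
    ultimately show ?thesis by auto
  qed
  ultimately show ?thesis unfolding discrete_imprecise_copula_def by blast
qed

lemma table_corner_tight: "corner_tight 9 \<P> \<Q>"
  unfolding corner_tight_def
proof (intro ballI impI conjI)
  fix r s assume "r \<in> L 9" "s \<in> L 9" and "\<P> r s \<noteq> \<Q> r s"
  then have "r < 10" "s < 10" "P\<^sub>9 r s \<noteq> Q\<^sub>9 r s" by auto
  then have gap: "Q\<^sub>9 r s = P\<^sub>9 r s + 1"
    and main: "\<exists>(i, j, k, l)\<in>set main_witnesses. (r, s) = (i, k) \<or> (r, s) = (j, l)"
    and opposite: "\<exists>(i, j, k, l)\<in>set opposite_witnesses. (r, s) = (i, l) \<or> (r, s) = (j, k)"
    using gaps_at_witnesses by blast+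
  show "(\<exists>i\<in>{r<..9}. \<exists>j\<in>{s<..9}. \<Q> r s + \<P> i j = \<P> r j + \<P> i s) \<or>
      (\<exists>i\<in>{1..r}. \<exists>j\<in>{1..s}. \<P> i j + \<Q> r s = \<P> i s + \<P> r j)"
  proof -
    obtain i j k l where w: "(i, j, k, l) \<in> set main_witnesses"
      and corner: "r = i \<and> s = k \<or> r = j \<and> s = l"
      using main by auto
    have grid: "1 \<le> i" "i < j" "j \<le> 9" "1 \<le> k" "k < l" "l \<le> 9"
      using witnesses_in_grid[THEN bspec, OF UnI1, OF w] by simp_all
    have "P\<^sub>9 i k + P\<^sub>9 j l + 1 = P\<^sub>9 i l + P\<^sub>9 j k"
      using main_witnesses_defect[THEN bspec, OF w] by simp
    then have defect: "\<P> i k + \<P> j l + 1 = \<P> i l + \<P> j k" by linarith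
    from corner show ?thesis
    proof
      assume "r = i \<and> s = k"
      then have "j \<in> {r<..9}" "l \<in> {s<..9}" "\<Q> r s + \<P> j l = \<P> r l + \<P> j s"
        using grid defect gap by auto
      then show ?thesis by blast
    next
      assume "r = j \<and> s = l"
      then have "i \<in> {1..r}" "k \<in> {1..s}" "\<P> i k + \<Q> r s = \<P> i s + \<P> r k"
        using grid defect gap by auto
      then show ?thesis by blast
    qed
  qed
  show "(\<exists>i\<in>{r<..9}. \<exists>j\<in>{1..s}. \<Q> r j + \<Q> i s = \<P> r s + \<Q> i j) \<or>
      (\<exists>i\<in>{1..r}. \<exists>j\<in>{s<..9}. \<Q> i s + \<Q> r j = \<Q> i j + \<P> r s)"
  proof -
    obtain i j k l where w: "(i, j, k, l) \<in> set opposite_witnesses"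
      and corner: "r = i \<and> s = l \<or> r = j \<and> s = k"
      using opposite by auto
    have grid: "1 \<le> i" "i < j" "j \<le> 9" "1 \<le> k" "k < l" "l \<le> 9"
      using witnesses_in_grid[THEN bspec, OF UnI2, OF w] by simp_all
    have "Q\<^sub>9 i k + Q\<^sub>9 j l + 1 = Q\<^sub>9 i l + Q\<^sub>9 j k"
      using opposite_witnesses_defect[THEN bspec, OF w] by simp
    then have defect: "\<Q> i k + \<Q> j l + 1 = \<Q> i l + \<Q> j k" by linarith
    from corner show ?thesis
    proof
      assume "r = i \<and> s = l"
      then have "j \<in> {r<..9}" "k \<in> {1..s}" "\<Q> r k + \<Q> j s = \<P> r s + \<Q> j k"
        using grid defect gap by auto
      then show ?thesis by blast
    next
      assume "r = j \<and> s = k"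
      then have "i \<in> {1..r}" "l \<in> {s<..9}" "\<Q> i s + \<Q> r l = \<Q> i l + \<P> r s"
        using grid defect gap by auto
      then show ?thesis by blast
    qed
  qed
qed

section \<open>A region with two holes that no copula can fill\<close>

theorem proposition4p5:
  fixes n :: nat
  assumes "n \<ge> 17"
  shows "\<exists>P Q :: nat \<Rightarrow> nat \<Rightarrow> real.
    discrete_imprecise_copula n P Q \<and> self_dual n P Q \<and>
    discrete_quasi_copula n P \<and> minimal_range n P \<and>
    discrete_quasi_copula n Q \<and> minimal_range n Q \<and>
    \<not> avoids_sure_loss n P Q"
proof -
  have n: "9 \<le> n" using assms by simp
  let ?P = "direct_sum_min 9 \<P>" and ?Q = "direct_sum_min 9 \<Q>"
  have ic: "discrete_imprecise_copula n ?P ?Q"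
    by (rule direct_sum_min_imprecise_copula[OF table_imprecise_copula n])
  have bd: "boundary_condition 9 \<P>" "boundary_condition 9 \<Q>"
    using table_imprecise_copula unfolding discrete_imprecise_copula_def by auto
  have dual: "self_dual n ?P ?Q"
    using ic direct_sum_min_corner_tight[OF table_corner_tight n bd]
    by (rule self_dual_if_corner_tight)
  note quasi = imprecise_copula_imp_quasi_copula[OF ic]
  have "minimal_range n ?P" "minimal_range n ?Q"
    by (rule minimal_rangeI;
        use ic in \<open>simp add: discrete_imprecise_copula_def direct_sum_min_Nats\<close>)+
  moreover have "\<not> avoids_sure_loss n ?P ?Q"
  proof
    assume "avoids_sure_loss n ?P ?Q"
    then obtain C where C: "discrete_copula n C"
      and between: "\<And>r s. r \<le> n \<Longrightarrow> s \<le> n \<Longrightarrow> ?P r s \<le> C r s \<and> C r s \<le> ?Q r s"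
      unfolding avoids_sure_loss_def by auto
    have bounds: "\<P> r s \<le> C r s \<and> C r s \<le> \<Q> r s" if "r \<le> 9" "s \<le> 9" for r s
      using between[of r s] that n by simp
    \<comment> \<open>Cutting at column 3 puts the two holes into different halves of the large rectangle.\<close>
    have "V C (3, 6, 2, 3) + V C (4, 5, 4, 5) \<le> V C (2, 7, 1, 3) + V C (2, 7, 3, 6)"
      using n by (intro add_mono copula_V_mono[OF C]) auto
    also have "\<dots> = V C (2, 7, 1, 6)"
      by (rule V_additive_columns[symmetric])
    also have "V C (2, 7, 1, 6) \<le> 1"
      using bounds[of 2 1] bounds[of 7 6] bounds[of 2 6] bounds[of 7 1]
      by (simp add: lookup)
    finally have "V C (3, 6, 2, 3) + V C (4, 5, 4, 5) \<le> 1" .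
    moreover have "1 \<le> V C (3, 6, 2, 3)"
      using bounds[of 3 2] bounds[of 6 3] bounds[of 3 3] bounds[of 6 2]
      by (simp add: lookup)
    moreover have "1 \<le> V C (4, 5, 4, 5)"
      using bounds[of 4 4] bounds[of 5 5] bounds[of 4 5] bounds[of 5 4]
      by (simp add: lookup)
    ultimately show False by linarith
  qed
  ultimately show ?thesis using ic dual quasi by blast
qed

end
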